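(* Let $\mathcal{X},\mathcal{Y},\mathcal{Z}$ be nonempty finite sets, let $f:\mathcal{X}\times\mathcal{Y}\to\mathcal{Z}\cup\{*\}$ be a (partial) function, let $\rho$ be a rectangular distribution on $\mathcal{X}\times\mathcal{Y}$, and let $z\in\mathcal{Z}$ satisfy $\rho(f^{-1}(z))\ge 3/20$. Let $\varepsilon,\varepsilon'$ be reals with $0\le 384\varepsilon\le\varepsilon'<1/4$. Then \[ \mathrm{IC}^\rho_\varepsilon(f)\ \ge\ \frac{1}{400}\,\mathrm{scb}^{z,\rho}_{\varepsilon',\varepsilon}(f)-\frac{1}{50}. \]
   Context: Two-party communication: Alice gets $x\in\mathcal{X}$, Bob gets $y\in\mathcal{Y}$; a protocol $P$ may use public randomness $R$ and private randomness; its transcript $P(x,y)$ is a bit string ending with an encoding of the output $\mathrm{out}(P(x,y))$. The value $f(x,y)=*$ means $f$ is undefined there (any output is correct). For a distribution $\lambda$ on $\mathcal{X}\times\mathcal{Y}$ and $(X,Y)\sim\lambda$, $P$ computes $f$ with error $\varepsilon$ if $\Pr[f(X,Y)\ne *\ \wedge\ \mathrm{out}(P(X,Y))\ne f(X,Y)]\le\varepsilon$, probability over $(X,Y)\sim\lambda$ and the randomness of $P$. The information cost is $\mathrm{icost}^\lambda(P)=I(XY:P(X,Y)\mid R)$ and $\mathrm{IC}^\lambda_\varepsilon(f)=\min\{\mathrm{icost}^\lambda(P): P \text{ computes } f \text{ with error } \varepsilon\}$. A distribution $\rho$ is rectangular if $\rho=\rho_1\otimes\rho_2$ for distributions $\rho_1$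 on $\mathcal{X}$, $\rho_2$ on $\mathcal{Y}$. A set $S\subseteq\mathcal{X}\times\mathcal{Y}$ is a rectangle if $S=S_1\times S_2$. For $g:\mathcal{X}\times\mathcal{Y}\to\mathcal{Z}\cup\{*\}$, a set $S$ is $\varepsilon$-error $z$-monochromatic for $g$ under $\lambda$ if $\lambda(S\setminus(g^{-1}(z)\cup g^{-1}( * )))\le\varepsilon\lambda(S)$. Define $\mathrm{cb}^{z,\lambda}_\varepsilon(g)=-\log_2\max\{\lambda(S): S \text{ a rectangle that is } \varepsilon\text{-error } z\text{-monochromatic for } g \text{ under } \lambda\}$, and the smooth corruption bound $\mathrm{scb}^{z,\lambda}_{\varepsilon,\delta}(f)=\max\{\mathrm{cb}^{z,\lambda}_\varepsilon(g): g:\mathcal{X}\times\mathcal{Y}\to\mathcal{Z}\cup\{*\},\ \Pr_{(X,Y)\sim\lambda}[f(X,Y)\ne g(X,Y)]\le\delta\}$. *)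

theory Defs
  imports "HOL-Probability.Probability" "HOL-Library.Sublist"
begin

text \<open>A partial function into \<open>\<Z>\<close> is a function into \<open>'z option\<close>;
  the value \<open>None\<close> plays the role of \<open>*\<close>.\<close>

text \<open>At an internal node its owner sends one bit, computed from the owner's input and the
  owner's private random string; the subtrees continue after bit 0 and bit 1, respectively.
  Random strings (private and public) are coded as natural numbers with an arbitrary discrete
  distribution.\<close>

datatype ('x, 'y) ptree =
    Halt
  | Alice "'x \<Rightarrow> nat \<Rightarrow> bool" "('x, 'y) ptree" "('x, 'y) ptree"
  | Bob "'y \<Rightarrow> nat \<Rightarrow> bool" "('x, 'y) ptree" "('x, 'y) ptree"

primrec tree_transcript :: "('x, 'y) ptree \<Rightarrow> 'x \<Rightarrow> nat \<Rightarrow> 'y \<Rightarrow> nat \<Rightarrow> bool list" where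
  "tree_transcript Halt x a y b = []"
| "tree_transcript (Alice m t0 t1) x a y b =
     (if m x a then True # tree_transcript t1 x a y b else False # tree_transcript t0 x a y b)"
| "tree_transcript (Bob m t0 t1) x a y b =
     (if m y b then True # tree_transcript t1 x a y b else False # tree_transcript t0 x a y b)"

text \<open>The public random string selects the protocol tree that is executed.\<close>

record ('x, 'y, 'z) protocol =
  public_coins :: "nat pmf"
  alice_coins :: "nat pmf"
  bob_coins :: "nat pmf"
  tree :: "nat \<Rightarrow> ('x, 'y) ptree"
  encode :: "'z \<Rightarrow> bool list"

text \<open>Every transcript ends with an encoding of an output. No code word is a suffix of another
  one, so that the output can be read off unambiguously from the end of the transcript.\<close>

definition valid_protocol :: "('x, 'y, 'z) protocol \<Rightarrow> bool" where
  "valid_protocol P \<longleftrightarrow>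
     (\<forall>z z'. suffix (encode P z) (encode P z') \<longrightarrow> z = z') \<and>
     (\<forall>x y. \<forall>r\<in>set_pmf (public_coins P). \<forall>a\<in>set_pmf (alice_coins P). \<forall>b\<in>set_pmf (bob_coins P).
        \<exists>z. suffix (encode P z) (tree_transcript (tree P r) x a y b))"

definition out :: "('x, 'y, 'z) protocol \<Rightarrow> bool list \<Rightarrow> 'z" where
  "out P t = (THE z. suffix (encode P z) t)"

text \<open>The joint distribution of input pair, transcript and public randomness.\<close>

definition execution ::
    "('x, 'y, 'z) protocol \<Rightarrow> ('x \<times> 'y) pmf \<Rightarrow> (('x \<times> 'y) \<times> bool list \<times> nat) pmf" where
  "execution P \<mu> =
     map_pmf (\<lambda>((x, y), r, a, b). ((x, y), tree_transcript (tree P r) x a y b, r))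
       (pair_pmf \<mu> (pair_pmf (public_coins P) (pair_pmf (alice_coins P) (bob_coins P))))"

definition computes ::
    "('x, 'y, 'z) protocol \<Rightarrow> ('x \<times> 'y) pmf \<Rightarrow> real \<Rightarrow> ('x \<times> 'y \<Rightarrow> 'z option) \<Rightarrow> bool" where
  "computes P \<mu> \<epsilon> f \<longleftrightarrow>
     measure_pmf.prob (execution P \<mu>)
       {(xy, t, r). f xy \<noteq> None \<and> Some (out P t) \<noteq> f xy} \<le> \<epsilon>"

definition icost :: "('x, 'y, 'z) protocol \<Rightarrow> ('x \<times> 'y) pmf \<Rightarrow> real" where
  "icost P \<mu> =
     prob_space.conditional_mutual_information (measure_pmf (execution P \<mu>)) 2
       (count_space UNIV) (count_space UNIV) (count_space UNIV)
       (\<lambda>(xy, t, r). xy) (\<lambda>(xy, t, r). t) (\<lambda>(xy, t, r). r)"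

definition IC :: "('x \<times> 'y) pmf \<Rightarrow> real \<Rightarrow> ('x \<times> 'y \<Rightarrow> 'z option) \<Rightarrow> ereal" where
  "IC \<mu> \<epsilon> f =
     Inf {ereal (icost P \<mu>) | P :: ('x, 'y, 'z) protocol. valid_protocol P \<and> computes P \<mu> \<epsilon> f}"

definition rectangular :: "('x \<times> 'y) pmf \<Rightarrow> bool" where
  "rectangular \<rho> \<longleftrightarrow> (\<exists>\<rho>1 \<rho>2. \<rho> = pair_pmf \<rho>1 \<rho>2)"

definition rectangle :: "('x \<times> 'y) set \<Rightarrow> bool" where
  "rectangle S \<longleftrightarrow> (\<exists>S1 S2. S = S1 \<times> S2)"

definition monochromatic ::
    "real \<Rightarrow> 'z \<Rightarrow> ('x \<times> 'y \<Rightarrow> 'z option) \<Rightarrow> ('x \<times> 'y) pmf \<Rightarrow> ('x \<times> 'y) set \<Rightarrow> bool" where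
  "monochromatic \<epsilon> z g \<mu> S \<longleftrightarrow>
     measure_pmf.prob \<mu> (S - (g -` {Some z} \<union> g -` {None})) \<le> \<epsilon> * measure_pmf.prob \<mu> S"

text \<open>The convention \<open>- log\<^sub>2 0 = \<infinity>\<close> is needed because the empty rectangle is always
  monochromatic and may be the best one, whereas \<open>log 2 0 = 0\<close> in the library.\<close>

definition neg_log2 :: "real \<Rightarrow> ereal" where
  "neg_log2 p = (if p = 0 then \<infinity> else ereal (- log 2 p))"

definition cb :: "'z \<Rightarrow> ('x::finite \<times> 'y::finite) pmf \<Rightarrow> real \<Rightarrow> ('x \<times> 'y \<Rightarrow> 'z option) \<Rightarrow> ereal" where
  "cb z \<mu> \<epsilon> g =
     neg_log2 (Max {measure_pmf.prob \<mu> S | S. rectangle S \<and> monochromatic \<epsilon> z g \<mu> S})"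

definition scb ::
    "'z::finite \<Rightarrow> ('x::finite \<times> 'y::finite) pmf \<Rightarrow> real \<Rightarrow> real \<Rightarrow> ('x \<times> 'y \<Rightarrow> 'z option) \<Rightarrow> ereal" where
  "scb z \<mu> \<epsilon> \<delta> f =
     Max {cb z \<mu> \<epsilon> g | g. measure_pmf.prob \<mu> {xy. f xy \<noteq> g xy} \<le> \<delta>}"

end

theory Submission
  imports Defs
begin

text \<open>
  Since the public coins are independent of the inputs, the information cost is the average, over
  the observation \<open>w\<close> (transcript and public coins), of the relative entropy \<open>D\<close> of the input
  distribution conditioned on \<open>w\<close> with respect to \<open>\<rho>\<close>. By averaging, some \<open>w\<close> with output \<open>z\<close>
  has both \<open>D = O(icost + 1)\<close> and a conditional probability at most \<open>\<epsilon>' / 4\<close> of inputs with \<open>g\<close>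
  defined and different from \<open>z\<close>. The event of observing \<open>w\<close> is a rectangle in inputs and private
  coins, so the conditional distribution has a density \<open>\<alpha>(x) \<beta>(y)\<close> with respect to \<open>\<rho>\<close>.
  By Markov's inequality for the relative entropy, truncating \<open>\<alpha>\<close> and \<open>\<beta>\<close> to values at most \<open>2\<^sup>L\<close>
  with \<open>L = O(D + 1)\<close> keeps half of the mass. The mass minus \<open>1/\<epsilon>'\<close> times the bad mass is a
  bilinear form in the truncated pair that is at least \<open>1/4\<close>; its maximum over the cube
  \<open>[0, 2\<^sup>L]\<close> is attained at a vertex, that is, at a pair of indicators scaled by \<open>2\<^sup>L\<close>, and these
  indicators span the large monochromatic rectangle.
\<close>

section \<open>Linear and bilinear forms on a cube\<close>

text \<open>Raising a weight to \<open>M\<close> where its coefficient is positive and lowering it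
  to 0 elsewhere can only increase the form.\<close>

lemma linear_form_le_vertex:
  fixes a c :: "'a::finite \<Rightarrow> real"
  assumes "\<And>x. 0 \<le> a x" "\<And>x. a x \<le> M"
  shows "\<exists>S. (\<Sum>x\<in>UNIV. a x * c x) \<le> M * (\<Sum>x\<in>S. c x)"
proof
  let ?S = "{x. c x > 0}"
  have "(\<Sum>x\<in>UNIV. a x * c x) \<le> (\<Sum>x\<in>UNIV. if x \<in> ?S then M * c x else 0)"
    by (intro sum_mono) (auto simp: assms mult_right_mono mult_nonneg_nonpos)
  also have "\<dots> = (\<Sum>x\<in>?S. M * c x)"
    by (simp flip: sum.inter_filter)
  finally show "(\<Sum>x\<in>UNIV. a x * c x) \<le> M * (\<Sum>x\<in>?S. c x)"
    by (simp add: sum_distrib_left)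
qed

text \<open>The form is linear in each argument separately: first \<open>a\<close> moves to a vertex
  with \<open>b\<close> fixed, then \<open>b\<close> with \<open>S\<close> fixed. Each move
  contributes one factor \<open>M\<close>.\<close>

lemma bilinear_form_le_vertex:
  fixes a :: "'a::finite \<Rightarrow> real" and b :: "'b::finite \<Rightarrow> real" and K :: "'a \<Rightarrow> 'b \<Rightarrow> real"
  assumes a: "\<And>x. 0 \<le> a x" "\<And>x. a x \<le> M" and b: "\<And>y. 0 \<le> b y" "\<And>y. b y \<le> M"
  shows "\<exists>S T. (\<Sum>x\<in>UNIV. \<Sum>y\<in>UNIV. a x * b y * K x y) \<le> M\<^sup>2 * (\<Sum>x\<in>S. \<Sum>y\<in>T. K x y)"
proof -
  have M: "0 \<le> M" using a order_trans by blast
  obtain S where S: "(\<Sum>x\<in>UNIV. a x * (\<Sum>y\<in>UNIV. b y * K x y))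
      \<le> M * (\<Sum>x\<in>S. \<Sum>y\<in>UNIV. b y * K x y)"
    using linear_form_le_vertex[of a M "\<lambda>x. \<Sum>y\<in>UNIV. b y * K x y"] a by blast
  obtain T where T: "(\<Sum>y\<in>UNIV. b y * (\<Sum>x\<in>S. K x y)) \<le> M * (\<Sum>y\<in>T. \<Sum>x\<in>S. K x y)"
    using linear_form_le_vertex[of b M "\<lambda>y. \<Sum>x\<in>S. K x y"] b by blast
  have "(\<Sum>x\<in>UNIV. \<Sum>y\<in>UNIV. a x * b y * K x y) = (\<Sum>x\<in>UNIV. a x * (\<Sum>y\<in>UNIV. b y * K x y))"
    by (simp add: sum_distrib_left mult.assoc)
  also have "\<dots> \<le> M * (\<Sum>x\<in>S. \<Sum>y\<in>UNIV. b y * K x y)"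
    by (rule S)
  also have "(\<Sum>x\<in>S. \<Sum>y\<in>UNIV. b y * K x y) = (\<Sum>y\<in>UNIV. b y * (\<Sum>x\<in>S. K x y))"
    by (subst sum.swap) (simp add: sum_distrib_left)
  also have "M * \<dots> \<le> M * (M * (\<Sum>y\<in>T. \<Sum>x\<in>S. K x y))"
    using T M by (rule mult_left_mono)
  also have "\<dots> = M\<^sup>2 * (\<Sum>x\<in>S. \<Sum>y\<in>T. K x y)"
    by (subst sum.swap) (simp add: power2_eq_square)
  finally show ?thesis by blast
qed

section \<open>Relative entropy of densities on finite sets\<close>

text \<open>The minimum of \<open>u * ln u\<close> is \<open>- 1 / exp 1\<close>. The rational
  constant 3/5 is (2/5) / (2/3), from \<open>exp 1 \<ge> 5 / 2\<close> and
  \<open>ln 2 \<ge> 2 / 3\<close>.\<close>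

lemma mult_log2_ge: "- (3 / 5) \<le> u * log 2 u" if "0 \<le> u" for u :: real
proof (cases "u = 0")
  case False
  with that have u: "u > 0" by simp
  have "ln (1 / (exp 1 * u)) \<le> 1 / (exp 1 * u) - 1"
    using u by (intro ln_le_minus_one) simp
  then have "- ln u \<le> 1 / (exp 1 * u)"
    using u by (simp add: ln_div ln_mult)
  then have "u * ln u \<ge> - (1 / exp 1)"
    using u by (simp add: field_simps)
  moreover have "1 / exp (1::real) \<le> 2 / 5"
    using exp_lower_Taylor_quadratic[of "1::real"] by (simp add: field_simps)
  moreover have "ln (2::real) \<ge> 2 / 3"
    by (rule ln2_ge_two_thirds)
  ultimately have "- (3 / 5) * ln 2 \<le> u * ln u" by linarith
  then show ?thesis by (simp add: log_def field_simps)
qed simp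

text \<open>The left side is the tangent at \<open>u = 1\<close> of a convex function.\<close>

lemma mult_log2_ge_linear: "(u - 1) / ln 2 \<le> u * log 2 u" if "0 \<le> u" for u :: real
proof (cases "u = 0")
  case False
  with that have u: "u > 0" by simp
  have "ln (1 / u) \<le> 1 / u - 1"
    using u by (intro ln_le_minus_one) simp
  then have "u - 1 \<le> u * ln u"
    using u by (simp add: ln_div field_simps)
  then show ?thesis by (simp add: log_def divide_right_mono)
qed simp

text \<open>Gibbs' inequality: the tangent bounds average to 0 because \<alpha> has mean 1.\<close>

lemma relative_entropy_nonneg:
  fixes p :: "'a::finite pmf"
  assumes "\<And>x. 0 \<le> \<alpha> x" "(\<Sum>x\<in>UNIV. pmf p x * \<alpha> x) = 1"
  shows "0 \<le> (\<Sum>x\<in>UNIV. pmf p x * (\<alpha> x * log 2 (\<alpha> x)))"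
proof -
  have "0 = (\<Sum>x\<in>UNIV. pmf p x * ((\<alpha> x - 1) / ln 2))"
    using assms(2) sum_pmf_eq_1[of UNIV p]
    by (simp add: sum_subtractf right_diff_distrib flip: sum_divide_distrib)
  also have "\<dots> \<le> (\<Sum>x\<in>UNIV. pmf p x * (\<alpha> x * log 2 (\<alpha> x)))"
    by (intro sum_mono mult_left_mono mult_log2_ge_linear assms pmf_nonneg)
  finally show ?thesis .
qed

text \<open>A Markov inequality that holds pointwise: on the tail the logarithm exceeds
  \<open>L\<close>, and elsewhere 3/5 compensates for negative values of
  \<open>\<alpha> x * log 2 (\<alpha> x)\<close>.\<close>

lemma relative_entropy_tail:
  fixes p :: "'a::finite pmf"
  assumes \<alpha>: "\<And>x. 0 \<le> \<alpha> x" and L: "0 \<le> L"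
  shows "L * (\<Sum>x\<in>UNIV. pmf p x * (if \<alpha> x \<le> 2 powr L then 0 else \<alpha> x))
    \<le> (\<Sum>x\<in>UNIV. pmf p x * (\<alpha> x * log 2 (\<alpha> x))) + 3 / 5"
proof -
  have *: "L * (if \<alpha> x \<le> 2 powr L then 0 else \<alpha> x) \<le> \<alpha> x * log 2 (\<alpha> x) + 3 / 5" for x
  proof (cases "\<alpha> x \<le> 2 powr L")
    case True
    then show ?thesis using mult_log2_ge[OF \<alpha>, of x] by simp
  next
    case False
    then have "0 < \<alpha> x"
      using powr_ge_zero[of 2 L] by linarith
    then have "L < log 2 (\<alpha> x)"
      using False by (simp add: less_log_iff)
    then have "L * \<alpha> x \<le> \<alpha> x * log 2 (\<alpha> x)"
      using \<open>0 < \<alpha> x\<close> by simp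
    then show ?thesis using False by simp
  qed
  have "L * (\<Sum>x\<in>UNIV. pmf p x * (if \<alpha> x \<le> 2 powr L then 0 else \<alpha> x))
      = (\<Sum>x\<in>UNIV. pmf p x * (L * (if \<alpha> x \<le> 2 powr L then 0 else \<alpha> x)))"
    by (simp add: sum_distrib_left mult_ac)
  also have "\<dots> \<le> (\<Sum>x\<in>UNIV. pmf p x * (\<alpha> x * log 2 (\<alpha> x) + 3 / 5))"
    by (intro sum_mono mult_left_mono * pmf_nonneg)
  also have "\<dots> = (\<Sum>x\<in>UNIV. pmf p x * (\<alpha> x * log 2 (\<alpha> x))) + 3 / 5"
    using sum_pmf_eq_1[of UNIV p]
    by (simp add: distrib_left sum.distrib flip: sum_divide_distrib sum_distrib_right)
  finally show ?thesis .
qed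

text \<open>The logarithm of the product splits, and in each summand the other density integrates to
  1. Points where a factor vanishes contribute 0 to both sides.\<close>

lemma relative_entropy_product:
  fixes p :: "'a::finite pmf" and q :: "'b::finite pmf"
  assumes "\<And>x. 0 \<le> \<alpha> x" "\<And>y. 0 \<le> \<beta> y"
    and "(\<Sum>x\<in>UNIV. pmf p x * \<alpha> x) = 1" "(\<Sum>y\<in>UNIV. pmf q y * \<beta> y) = 1"
  shows "(\<Sum>x\<in>UNIV. \<Sum>y\<in>UNIV. pmf p x * pmf q y * (\<alpha> x * \<beta> y * log 2 (\<alpha> x * \<beta> y)))
    = (\<Sum>x\<in>UNIV. pmf p x * (\<alpha> x * log 2 (\<alpha> x))) + (\<Sum>y\<in>UNIV. pmf q y * (\<beta> y * log 2 (\<beta> y)))"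
proof -
  have *: "pmf p x * pmf q y * (\<alpha> x * \<beta> y * log 2 (\<alpha> x * \<beta> y)) =
    pmf p x * (\<alpha> x * log 2 (\<alpha> x)) * (pmf q y * \<beta> y) + pmf p x * \<alpha> x * (pmf q y * (\<beta> y * log 2 (\<beta> y)))"
    for x y
    by (cases "\<alpha> x = 0 \<or> \<beta> y = 0")
      (use assms(1)[of x] assms(2)[of y] in \<open>auto simp: log_mult algebra_simps\<close>)
  show ?thesis
    unfolding * sum.distrib
    by (simp add: assms flip: sum_distrib_left sum_distrib_right)
qed

section \<open>Rectangles extracted from product densities\<close>

lemma prob_pair_pmf_rectangle:
  fixes p :: "'a::finite pmf" and q :: "'b::finite pmf"
  shows "measure_pmf.prob (pair_pmf p q) (S \<times> T \<inter> B)
    = (\<Sum>x\<in>S. \<Sum>y\<in>T. pmf p x * pmf q y * indicator B (x, y))"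
proof -
  have "measure_pmf.prob (pair_pmf p q) (S \<times> T \<inter> B) = (\<Sum>v\<in>S \<times> T \<inter> B. pmf (pair_pmf p q) v)"
    by (rule measure_measure_pmf_finite) simp
  also have "\<dots> = (\<Sum>v\<in>S \<times> T. pmf (pair_pmf p q) v * indicator B v)"
    by (simp add: indicator_def sum.inter_restrict if_distrib cong: if_cong)
  also have "\<dots> = (\<Sum>(x, y)\<in>S \<times> T. pmf p x * pmf q y * indicator B (x, y))"
    by (intro sum.cong) (auto simp: pmf_pair)
  finally show ?thesis
    by (simp only: sum.cartesian_product)
qed

text \<open>\<open>B\<close> is the set of bad inputs and \<open>D\<close> the relative entropy of
  the density. The exponent is \<open>2 * L + 2\<close>: the vertex argument costs the factor
  \<open>(2 powr L)\<^sup>2\<close>, and the bilinear form is at least 1/4.\<close>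

lemma large_rectangle_of_product_density:
  fixes p :: "'a::finite pmf" and q :: "'b::finite pmf"
  assumes \<alpha>: "\<And>x. 0 \<le> \<alpha> x" "(\<Sum>x\<in>UNIV. pmf p x * \<alpha> x) = 1"
    and \<beta>: "\<And>y. 0 \<le> \<beta> y" "(\<Sum>y\<in>UNIV. pmf q y * \<beta> y) = 1"
    and e: "0 < e"
    and B: "(\<Sum>x\<in>UNIV. \<Sum>y\<in>UNIV. pmf p x * pmf q y * (\<alpha> x * \<beta> y) * indicator B (x, y)) \<le> e / 4"
    and D: "(\<Sum>x\<in>UNIV. \<Sum>y\<in>UNIV. pmf p x * pmf q y * (\<alpha> x * \<beta> y * log 2 (\<alpha> x * \<beta> y))) = D"
  shows "\<exists>S T. measure_pmf.prob (pair_pmf p q) (S \<times> T \<inter> B) \<le> e * measure_pmf.prob (pair_pmf p q) (S \<times> T)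
    \<and> 2 powr - (4 * D + 34 / 5) \<le> measure_pmf.prob (pair_pmf p q) (S \<times> T)"
proof -
  define D1 where "D1 = (\<Sum>x\<in>UNIV. pmf p x * (\<alpha> x * log 2 (\<alpha> x)))"
  define D2 where "D2 = (\<Sum>y\<in>UNIV. pmf q y * (\<beta> y * log 2 (\<beta> y)))"
  have D12: "D = D1 + D2" "0 \<le> D1" "0 \<le> D2"
    using relative_entropy_product[OF \<alpha>(1) \<beta>(1) \<alpha>(2) \<beta>(2)] D relative_entropy_nonneg[of \<alpha> p]
      relative_entropy_nonneg[of \<beta> q] \<alpha> \<beta> by (auto simp: D1_def D2_def)
  \<comment> \<open>The two tail bounds add up to \<open>D + 6 / 5\<close>, which is
    \<open>L / 2\<close>; so the truncations lose mass at most 1/2 in total.\<close>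
  define L where "L = 2 * (D + 6 / 5)"
  have L: "0 < L" using D12 by (simp add: L_def)
  define a where "a x = (if \<alpha> x \<le> 2 powr L then \<alpha> x else 0)" for x
  define b where "b y = (if \<beta> y \<le> 2 powr L then \<beta> y else 0)" for y
  define ta where "ta = (\<Sum>x\<in>UNIV. pmf p x * (if \<alpha> x \<le> 2 powr L then 0 else \<alpha> x))"
  define tb where "tb = (\<Sum>y\<in>UNIV. pmf q y * (if \<beta> y \<le> 2 powr L then 0 else \<beta> y))"
  have nn: "0 \<le> ta" "0 \<le> tb"
    unfolding ta_def tb_def by (auto intro!: sum_nonneg simp: \<alpha> \<beta>)
  have "L * ta \<le> D1 + 3 / 5" "L * tb \<le> D2 + 3 / 5"
    unfolding ta_def tb_def D1_def D2_def
    using L \<alpha>(1) \<beta>(1) by (auto intro!: relative_entropy_tail)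
  then have "L * (ta + tb) \<le> D + 6 / 5"
    using D12 by (simp add: distrib_left)
  also have "\<dots> = L * (1 / 2)" by (simp add: L_def)
  finally have "L * (ta + tb) \<le> L * (1 / 2)" .
  then have t: "ta + tb \<le> 1 / 2" using L by simp
  have "(\<Sum>x\<in>UNIV. pmf p x * a x) + ta = 1"
    unfolding ta_def a_def sum.distrib[symmetric] \<alpha>(2)[symmetric] by (intro sum.cong) auto
  moreover have "(\<Sum>y\<in>UNIV. pmf q y * b y) + tb = 1"
    unfolding tb_def b_def sum.distrib[symmetric] \<beta>(2)[symmetric] by (intro sum.cong) auto
  ultimately have "(\<Sum>x\<in>UNIV. pmf p x * a x) * (\<Sum>y\<in>UNIV. pmf q y * b y) = (1 - ta) * (1 - tb)"
    by (metis add_diff_cancel_right')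
  also have "\<dots> \<ge> 1 / 2"
    using t mult_nonneg_nonneg[OF nn] by (simp add: algebra_simps)
  finally have W: "1 / 2 \<le> (\<Sum>x\<in>UNIV. \<Sum>y\<in>UNIV. a x * b y * (pmf p x * pmf q y))"
    by (simp add: sum_product mult_ac)
  have "(\<Sum>x\<in>UNIV. \<Sum>y\<in>UNIV. a x * b y * (pmf p x * pmf q y * indicator B (x, y)))
      \<le> (\<Sum>x\<in>UNIV. \<Sum>y\<in>UNIV. pmf p x * pmf q y * (\<alpha> x * \<beta> y) * indicator B (x, y))"
    by (intro sum_mono) (auto simp: a_def b_def \<alpha> \<beta> indicator_def)
  with B have bad: "(\<Sum>x\<in>UNIV. \<Sum>y\<in>UNIV. a x * b y * (pmf p x * pmf q y * indicator B (x, y))) \<le> e / 4"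
    by linarith
  \<comment> \<open>Charging bad mass at rate \<open>1 / e\<close> makes the sum of \<open>K\<close>
    over a rectangle nonnegative exactly when at most a fraction \<open>e\<close> of its mass is
    bad.\<close>
  define K where "K x y = pmf p x * pmf q y - pmf p x * pmf q y * indicator B (x, y) / e" for x y
  have K: "(\<Sum>x\<in>UNIV. \<Sum>y\<in>UNIV. a x * b y * K x y)
    = (\<Sum>x\<in>UNIV. \<Sum>y\<in>UNIV. a x * b y * (pmf p x * pmf q y))
     - (\<Sum>x\<in>UNIV. \<Sum>y\<in>UNIV. a x * b y * (pmf p x * pmf q y * indicator B (x, y))) / e"
    by (simp add: K_def right_diff_distrib sum_subtractf sum_divide_distrib)
  have "(\<Sum>x\<in>UNIV. \<Sum>y\<in>UNIV. a x * b y * (pmf p x * pmf q y * indicator B (x, y))) / e \<le> 1 / 4"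
    using bad e by (simp add: field_simps)
  with K W have 1: "1 / 4 \<le> (\<Sum>x\<in>UNIV. \<Sum>y\<in>UNIV. a x * b y * K x y)" by linarith
  have ab: "0 \<le> a x" "a x \<le> 2 powr L" "0 \<le> b y" "b y \<le> 2 powr L" for x y
    by (auto simp: a_def b_def \<alpha> \<beta>)
  obtain S T where ST: "(\<Sum>x\<in>UNIV. \<Sum>y\<in>UNIV. a x * b y * K x y)
      \<le> (2 powr L)\<^sup>2 * (\<Sum>x\<in>S. \<Sum>y\<in>T. K x y)"
    using bilinear_form_le_vertex[of a "2 powr L" b K] ab by blast
  let ?m = "measure_pmf.prob (pair_pmf p q)"
  have "?m (S \<times> T) = (\<Sum>x\<in>S. \<Sum>y\<in>T. pmf p x * pmf q y)"
    using prob_pair_pmf_rectangle[of p q S T UNIV] by simp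
  then have "(\<Sum>x\<in>S. \<Sum>y\<in>T. K x y) = ?m (S \<times> T) - ?m (S \<times> T \<inter> B) / e"
    by (simp only: K_def sum_subtractf sum_divide_distrib prob_pair_pmf_rectangle[of p q S T B])
  moreover have "(2 powr L)\<^sup>2 = 2 powr (2 * L)"
    by (simp add: power2_eq_square flip: powr_add)
  ultimately have 2: "1 / 4 \<le> 2 powr (2 * L) * (?m (S \<times> T) - ?m (S \<times> T \<inter> B) / e)"
    using order_trans[OF 1 ST] by (simp only:)
  have quarter: "2 powr - 2 = (1 / 4 :: real)"
    using powr_minus[of 2 "2 :: real"] by simp
  have "2 powr - (4 * D + 34 / 5) = 2 powr (- 2 + - (2 * L))"
    by (simp add: L_def algebra_simps)
  also have "\<dots> = 2 powr - 2 * 2 powr - (2 * L)"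
    by (rule powr_add)
  also have "\<dots> = 1 / 4 / 2 powr (2 * L)"
    unfolding quarter by (simp only: powr_minus divide_inverse)
  also have "\<dots> \<le> ?m (S \<times> T) - ?m (S \<times> T \<inter> B) / e"
    using 2 by (simp add: divide_le_eq mult.commute)
  \<comment> \<open>Both conclusions follow from this: dropping the bad term bounds the size, and
    positivity of the left side bounds the bad mass.\<close>
  finally have 3: "2 powr - (4 * D + 34 / 5) \<le> ?m (S \<times> T) - ?m (S \<times> T \<inter> B) / e" .
  moreover have "0 \<le> ?m (S \<times> T \<inter> B) / e" using e by simp
  ultimately have "2 powr - (4 * D + 34 / 5) \<le> ?m (S \<times> T)" by linarith
  moreover have "0 \<le> ?m (S \<times> T) - ?m (S \<times> T \<inter> B) / e"
    using 3 powr_ge_zero[of 2 "- (4 * D + 34 / 5)"] by linarith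
  then have "?m (S \<times> T \<inter> B) \<le> e * ?m (S \<times> T)"
    using e by (simp add: field_simps)
  ultimately show ?thesis by blast
qed

section \<open>Information cost in terms of point masses\<close>

lemma distributed_pmf:
  "distributed (measure_pmf J) (count_space UNIV) X (\<lambda>x. ennreal (pmf (map_pmf X J) x))"
  unfolding distributed_def
  by (simp add: map_pmf_rep_eq[symmetric] measure_pmf_eq_density[symmetric])

text \<open>Countability makes the product of the counting measures the counting measure on pairs,
  so point masses serve as the densities.\<close>

lemma mutual_information_pmf:
  fixes X :: "'c \<Rightarrow> 'a::countable" and Y :: "'c \<Rightarrow> 'b::countable"
  shows "prob_space.mutual_information (measure_pmf J) 2 (count_space UNIV) (count_space UNIV) X Y =
    (\<integral>v. pmf (map_pmf (\<lambda>v. (X v, Y v)) J) v * log 2 (pmf (map_pmf (\<lambda>v. (X v, Y v)) J) v /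
      (pmf (map_pmf X J) (fst v) * pmf (map_pmf Y J) (snd v))) \<partial>count_space UNIV)"
proof -
  interpret information_space "measure_pmf J" 2
    by unfold_locales simp
  have cs: "count_space UNIV \<Otimes>\<^sub>M count_space UNIV = (count_space UNIV :: ('a \<times> 'b) measure)"
    by (simp add: pair_measure_countable)
  have *: "distributed (measure_pmf J) (count_space UNIV \<Otimes>\<^sub>M count_space UNIV) (\<lambda>v. (X v, Y v))
    (\<lambda>v. ennreal (pmf (map_pmf (\<lambda>v. (X v, Y v)) J) v))"
    unfolding cs by (rule distributed_pmf)
  show ?thesis
    by (subst mutual_information_distr[OF sigma_finite_measure_count_space
          sigma_finite_measure_count_space distributed_pmf _ distributed_pmf _ *])
       (auto simp: cs)
qed

lemma map_fst_execution: "map_pmf fst (execution P \<mu>) = \<mu>"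
  by (simp add: execution_def pmf.map_comp comp_def case_prod_unfold map_fst_pair_pmf)

text \<open>Conditional mutual information is defined as the information that transcript and public
  coins give together, minus that of the public coins alone. The latter is 0, since the public coins
  are independent of the inputs.\<close>

lemma icost_eq:
  fixes P :: "('x::finite, 'y::finite, 'z) protocol"
  shows "icost P \<mu> = (\<integral>v. pmf (execution P \<mu>) v *
    log 2 (pmf (execution P \<mu>) v / (pmf \<mu> (fst v) * pmf (map_pmf snd (execution P \<mu>)) (snd v)))
      \<partial>count_space UNIV)"
proof -
  let ?J = "execution P \<mu>"
  have eqs: "(\<lambda>(xy, t, r). xy) = fst" "(\<lambda>v. (case v of (xy, t, r) \<Rightarrow> t, case v of (xy, t, r) \<Rightarrow> r)) = snd"
    "(\<lambda>v. (fst v, snd v)) = id"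
    by auto
  have cs: "count_space UNIV \<Otimes>\<^sub>M count_space UNIV = (count_space UNIV :: (bool list \<times> nat) measure)"
    by (simp add: pair_measure_countable)
  have pair: "map_pmf (\<lambda>v. (fst v, snd (snd v))) ?J = pair_pmf \<mu> (public_coins P)"
  proof -
    have "map_pmf (\<lambda>v. (fst v, snd (snd v))) ?J =
      map_pmf (\<lambda>v. (id (fst v), fst (snd v)))
        (pair_pmf \<mu> (pair_pmf (public_coins P) (pair_pmf (alice_coins P) (bob_coins P))))"
      by (simp add: execution_def pmf.map_comp comp_def case_prod_unfold)
    also have "\<dots> = pair_pmf (map_pmf id \<mu>) (map_pmf fst (pair_pmf (public_coins P) (pair_pmf (alice_coins P) (bob_coins P))))"
      unfolding map_pair[symmetric] by (simp only: case_prod_unfold)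
    finally show ?thesis by (simp add: map_fst_pair_pmf)
  qed
  have r: "map_pmf (\<lambda>v. snd (snd v)) ?J = public_coins P"
    using arg_cong[OF pair, of "map_pmf snd"] by (simp add: pmf.map_comp comp_def map_snd_pair_pmf)
  \<comment> \<open>The joint point mass is the product of the marginal ones, so at each point it is
    0 or the logarithm is that of 1.\<close>
  have "prob_space.mutual_information (measure_pmf ?J) 2 (count_space UNIV) (count_space UNIV) fst (\<lambda>v. snd (snd v)) =
    (\<integral>v. 0 \<partial>count_space (UNIV :: (('x \<times> 'y) \<times> nat) set))"
    unfolding mutual_information_pmf pair map_fst_execution r
    by (intro Bochner_Integration.integral_cong) (auto simp: pmf_pair split: if_splits)
  moreover have "prob_space.mutual_information (measure_pmf ?J) 2 (count_space UNIV) (count_space UNIV) fst snd =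
    (\<integral>v. pmf ?J v * log 2 (pmf ?J v / (pmf \<mu> (fst v) * pmf (map_pmf snd ?J) (snd v))) \<partial>count_space UNIV)"
    unfolding mutual_information_pmf eqs map_fst_execution by simp
  ultimately show ?thesis
    unfolding icost_def prob_space.conditional_mutual_information_def[OF prob_space_measure_pmf] cs eqs(1,2)
    by (simp add: case_prod_unfold)
qed

section \<open>The rectangle property of protocols\<close>

text \<open>Each bit of \<open>t\<close> restricts only the input and coins of the node's owner. The
  induction generalises \<open>t\<close> because the subtree has to produce the rest of it.\<close>

lemma tree_transcript_rectangle:
  "\<exists>SA SB. \<forall>x a y b. tree_transcript T x a y b = t \<longleftrightarrow> a \<in> SA x \<and> b \<in> SB y"
proof (induction T arbitrary: t)
  case Halt
  show ?case
    by (rule exI[of _ "\<lambda>_. if t = [] then UNIV else {}"], rule exI[of _ "\<lambda>_. UNIV"]) auto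
next
  case (Alice m t0 t1)
  show ?case
  proof (cases t)
    case Nil
    then show ?thesis by (intro exI[of _ "\<lambda>_. {}"]) auto
  next
    case (Cons c u)
    obtain SA SB where S: "\<And>x a y b. tree_transcript (if c then t1 else t0) x a y b = u
        \<longleftrightarrow> a \<in> SA x \<and> b \<in> SB y"
      using Alice[of u] by (metis (full_types))
    show ?thesis
      by (rule exI[of _ "\<lambda>x. SA x \<inter> {a. m x a = c}"], rule exI[of _ SB])
        (use Cons S in \<open>cases c; auto\<close>)
  qed
next
  case (Bob m t0 t1)
  show ?case
  proof (cases t)
    case Nil
    then show ?thesis by (intro exI[of _ "\<lambda>_. {}"]) auto
  next
    case (Cons c u)
    obtain SA SB where S: "\<And>x a y b. tree_transcript (if c then t1 else t0) x a y b = u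
        \<longleftrightarrow> a \<in> SA x \<and> b \<in> SB y"
      using Bob[of u] by (metis (full_types))
    show ?thesis
      by (rule exI[of _ SA], rule exI[of _ "\<lambda>y. SB y \<inter> {b. m y b = c}"])
        (use Cons S in \<open>cases c; auto\<close>)
  qed
qed

text \<open>The private coins are independent, so the rectangle property factorises the probability
  of \<open>w\<close>. The probability of the public string is put into \<open>A\<close>.\<close>

lemma pmf_execution_product:
  "\<exists>A B. (\<forall>x. 0 \<le> A x) \<and> (\<forall>y. 0 \<le> B y) \<and>
    (\<forall>x y. pmf (execution P (pair_pmf p q)) ((x, y), w) = pmf p x * pmf q y * (A x * B y))"
proof -
  obtain t r where w: "w = (t, r)" by fastforce
  obtain SA SB where S: "\<And>x a y b. tree_transcript (tree P r) x a y b = t \<longleftrightarrow> a \<in> SA x \<and> b \<in> SB y"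
    using tree_transcript_rectangle[of "tree P r" t] by blast
  define A where "A x = pmf (public_coins P) r * measure_pmf.prob (alice_coins P) (SA x)" for x
  define B where "B y = measure_pmf.prob (bob_coins P) (SB y)" for y
  have "pmf (execution P (pair_pmf p q)) ((x, y), w) = pmf p x * pmf q y * (A x * B y)" for x y
  proof -
    have "(\<lambda>((x, y), r, a, b). ((x, y), tree_transcript (tree P r) x a y b, r)) -` {((x, y), w)}
        = {(x, y)} \<times> {r} \<times> SA x \<times> SB y"
      using S by (auto simp: w)
    then show ?thesis
      by (simp add: execution_def pmf_map measure_pmf_prob_product A_def B_def
          measure_pmf_single pmf_pair)
  qed
  moreover have "0 \<le> A x" "0 \<le> B y" for x y by (simp_all add: A_def B_def)
  ultimately show ?thesis by blast
qed

section \<open>Integrability and fibre sums of the information density\<close>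

lemma pmf_map_snd_finite:
  fixes J :: "('a::finite \<times> 'w) pmf"
  shows "pmf (map_pmf snd J) w = (\<Sum>v\<in>UNIV. pmf J (v, w))"
proof -
  have "pmf (map_pmf snd J) w = measure_pmf.prob J ((\<lambda>v. (v, w)) ` UNIV)"
    unfolding pmf_map by (rule arg_cong[of _ _ "measure_pmf.prob J"]) auto
  also have "\<dots> = (\<Sum>v\<in>UNIV. pmf J (v, w))"
    by (subst measure_measure_pmf_finite) (simp_all add: sum.reindex inj_on_def)
  finally show ?thesis .
qed

lemma pmf_le_map_pmf: "pmf J v \<le> pmf (map_pmf f J) (f v)"
  unfolding pmf_map by (simp flip: measure_pmf_single) (auto intro!: measure_pmf.finite_measure_mono)

lemma integral_count_space_finite_times:
  fixes h :: "'a::finite \<times> 'w::countable \<Rightarrow> real"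
  assumes "integrable (count_space UNIV) h"
  shows "integrable (count_space UNIV) (\<lambda>w. \<Sum>v\<in>UNIV. h (v, w))"
    and "(\<integral>v. h v \<partial>count_space UNIV) = (\<integral>w. (\<Sum>v\<in>UNIV. h (v, w)) \<partial>count_space UNIV)"
proof -
  interpret pair_sigma_finite "count_space (UNIV :: 'a set)" "count_space (UNIV :: 'w set)"
    by (simp add: pair_sigma_finite_def sigma_finite_measure_count_space)
  have cs: "count_space UNIV \<Otimes>\<^sub>M count_space UNIV = (count_space UNIV :: ('a \<times> 'w) measure)"
    by (simp add: pair_measure_countable)
  have h: "integrable (count_space UNIV \<Otimes>\<^sub>M count_space UNIV) (\<lambda>(v, w). h (v, w))"
    using assms by (simp add: cs)
  show "integrable (count_space UNIV) (\<lambda>w. \<Sum>v\<in>UNIV. h (v, w))"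
    using integrable_snd[OF h] by (simp add: lebesgue_integral_count_space_finite)
  show "(\<integral>v. h v \<partial>count_space UNIV) = (\<integral>w. (\<Sum>v\<in>UNIV. h (v, w)) \<partial>count_space UNIV)"
    using integral_snd[OF h] by (simp add: lebesgue_integral_count_space_finite cs)
qed

lemma integral_pmf_indicator:
  "integrable (count_space UNIV) (\<lambda>v. pmf J v * indicator E v :: real)"
  "(\<integral>v. pmf J v * indicator E v \<partial>count_space UNIV) = measure_pmf.prob J E"
proof -
  show "integrable (count_space UNIV) (\<lambda>v. pmf J v * indicator E v :: real)"
    by (rule Bochner_Integration.integrable_bound[OF integrable_pmf[of UNIV J]])
      (auto simp: indicator_def)
  have "measure_pmf.prob J E = (\<integral>v. indicator E v \<partial>measure_pmf J)" by simp
  also have "\<dots> = (\<integral>v. pmf J v * indicator E v \<partial>count_space UNIV)"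
    unfolding measure_pmf_eq_density by (subst integral_density) auto
  finally show "(\<integral>v. pmf J v * indicator E v \<partial>count_space UNIV) = measure_pmf.prob J E" by simp
qed

text \<open>With \<open>u\<close> the ratio inside the logarithm, \<open>log 2 u \<le> 2 * u\<close>
  and \<open>u \<le> 1 / m\<close> give the upper bound, and \<open>mult_log2_ge\<close> gives the
  lower one. For fixed \<open>v\<close> the bound is summable over \<open>w\<close>.\<close>

lemma information_density_bound:
  fixes J :: "('a \<times> 'w) pmf"
  shows "\<bar>pmf J (v, w) * log 2 (pmf J (v, w) / (pmf (map_pmf fst J) v * pmf (map_pmf snd J) w))\<bar>
    \<le> (1 + 2 / pmf (map_pmf fst J) v) * pmf (map_pmf snd J) w"
proof (cases "pmf J (v, w) = 0")
  case False
  define j m s where "j = pmf J (v, w)" and "m = pmf (map_pmf fst J) v" and "s = pmf (map_pmf snd J) w"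
  have j: "0 < j" using False by (simp add: j_def pmf_pos)
  have jm: "j \<le> m" "j \<le> s"
    using pmf_le_map_pmf[of J "(v, w)" fst] pmf_le_map_pmf[of J "(v, w)" snd]
    by (simp_all add: j_def m_def s_def)
  have m: "0 < m" "m \<le> 1" and s: "0 < s" using j jm by (auto simp: m_def pmf_le_1)
  define u where "u = j / (m * s)"
  have u: "0 < u" "j = m * s * u" using j m s by (auto simp: u_def)
  have um: "u \<le> 1 / m" using jm m s by (simp add: u_def field_simps)
  have "ln u \<le> u" using ln_le_minus_one[OF u(1)] by simp
  moreover have "u \<le> 2 * ln 2 * u" using ln2_ge_two_thirds u(1) by simp
  ultimately have "log 2 u \<le> 2 * u" by (simp add: log_def divide_le_eq mult_ac)
  then have "j * log 2 u \<le> j * (2 * u)" using j by simp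
  also have "\<dots> \<le> s * (2 * (1 / m))"
    using j jm um u(1) s by (intro mult_mono) auto
  also have "\<dots> \<le> (1 + 2 / m) * s" using s by (simp add: algebra_simps)
  finally have 1: "j * log 2 u \<le> (1 + 2 / m) * s" .
  have "- ((1 + 2 / m) * s) \<le> - (m * s)"
    using m s mult_right_mono[of m 1 s] by (simp add: algebra_simps add_increasing2)
  also have "\<dots> \<le> m * s * - (3 / 5)" using m s by simp
  also have "\<dots> \<le> m * s * (u * log 2 u)"
    using mult_log2_ge[of u] u m s by (intro mult_left_mono) auto
  also have "\<dots> = j * log 2 u" using u by simp
  finally have "- ((1 + 2 / m) * s) \<le> j * log 2 u" .
  with 1 show ?thesis
    unfolding j_def[symmetric] m_def[symmetric] s_def[symmetric] u_def[symmetric]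
    by (simp add: abs_le_iff minus_le_iff)
qed simp

lemma integrable_information_density:
  fixes J :: "('a::finite \<times> 'w) pmf"
  shows "integrable (count_space UNIV)
    (\<lambda>x. pmf J x * log 2 (pmf J x / (pmf (map_pmf fst J) (fst x) * pmf (map_pmf snd J) (snd x))))"
proof -
  define C where "C = (\<Sum>v\<in>UNIV. 1 + 2 / pmf (map_pmf fst J) v)"
  define U where "U = pmf_of_set (UNIV :: 'a set)"
  have C: "1 + 2 / pmf (map_pmf fst J) v \<le> C" for v
    unfolding C_def by (rule member_le_sum) auto
  have C0: "0 \<le> C" unfolding C_def by (intro sum_nonneg) auto
  \<comment> \<open>The cardinality cancels the uniform weight of \<open>U\<close>, so this
    dominating function is \<open>C\<close> times the marginal point mass of
    \<open>w\<close>.\<close>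
  have "integrable (count_space UNIV) (\<lambda>x. real (card (UNIV :: 'a set)) * C * pmf (pair_pmf U (map_pmf snd J)) x)"
    by (intro integrable_mult_right integrable_pmf)
  then show ?thesis
  proof (rule Bochner_Integration.integrable_bound)
    have "\<bar>pmf J (v, w) * log 2 (pmf J (v, w) / (pmf (map_pmf fst J) v * pmf (map_pmf snd J) w))\<bar>
      \<le> C * pmf (map_pmf snd J) w" for v w
      using information_density_bound[of J v w] mult_right_mono[OF C, of "pmf (map_pmf snd J) w" v]
      by simp
    then show "AE x in count_space UNIV. norm (pmf J x *
        log 2 (pmf J x / (pmf (map_pmf fst J) (fst x) * pmf (map_pmf snd J) (snd x))))
      \<le> norm (real (card (UNIV :: 'a set)) * C * pmf (pair_pmf U (map_pmf snd J)) x)"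
      using C0 by (simp add: AE_count_space pmf_pair U_def)
  qed simp
qed

lemma pmf_le_map_pmf_fst: "pmf J (v, w) \<le> pmf (map_pmf fst J) v"
  and pmf_le_map_pmf_snd: "pmf J (v, w) \<le> pmf (map_pmf snd J) w"
  using pmf_le_map_pmf[of J "(v, w)" fst] pmf_le_map_pmf[of J "(v, w)" snd] by simp_all

text \<open>The sum is the probability of \<open>w\<close> times the relative entropy of the first
  component conditioned on \<open>w\<close> with respect to its marginal.\<close>

lemma sum_information_density_nonneg:
  fixes J :: "('a::finite \<times> 'w) pmf"
  shows "0 \<le> (\<Sum>v\<in>UNIV. pmf J (v, w) *
    log 2 (pmf J (v, w) / (pmf (map_pmf fst J) v * pmf (map_pmf snd J) w)))"
proof (cases "pmf (map_pmf snd J) w = 0")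
  case True
  then have "pmf J (v, w) = 0" for v
    using pmf_le_map_pmf_snd[of J v w] pmf_nonneg[of J "(v, w)"] by simp
  then show ?thesis by simp
next
  case False
  define s where "s = pmf (map_pmf snd J) w"
  define \<alpha> where "\<alpha> v = pmf J (v, w) / (pmf (map_pmf fst J) v * s)" for v
  have s: "0 < s" using False by (simp add: s_def pmf_pos)
  \<comment> \<open>Where the marginal vanishes, so does \<open>J\<close>; division by zero does no
    harm there.\<close>
  have \<alpha>: "pmf (map_pmf fst J) v * \<alpha> v = pmf J (v, w) / s" for v
    using pmf_le_map_pmf_fst[of J v w] pmf_nonneg[of J "(v, w)"]
    by (cases "pmf (map_pmf fst J) v = 0") (auto simp: \<alpha>_def)
  have "(\<Sum>v\<in>UNIV. pmf (map_pmf fst J) v * \<alpha> v) = 1"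
    using s by (simp add: \<alpha> s_def pmf_map_snd_finite flip: sum_divide_distrib)
  then have "0 \<le> s * (\<Sum>v\<in>UNIV. pmf (map_pmf fst J) v * (\<alpha> v * log 2 (\<alpha> v)))"
    using s by (intro mult_nonneg_nonneg relative_entropy_nonneg) (auto simp: \<alpha>_def)
  also have "\<dots> = (\<Sum>v\<in>UNIV. s * (pmf (map_pmf fst J) v * \<alpha> v) * log 2 (\<alpha> v))"
    by (simp add: sum_distrib_left mult.assoc)
  also have "\<dots> = (\<Sum>v\<in>UNIV. pmf J (v, w) * log 2 (\<alpha> v))"
    using s by (simp add: \<alpha>)
  finally show ?thesis
    by (simp add: \<alpha>_def s_def)
qed

section \<open>Choice of an observation by averaging\<close>

text \<open>All three requirements are combined into one function with negative integral, which must
  have a negative fibre sum at some \<open>w\<close>. The bound \<open>I\<close> is strict and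
  positive so that division by it is possible even when the information is 0.\<close>

lemma exists_good_observation:
  fixes J :: "('a::finite \<times> 'w::countable) pmf"
  assumes I: "(\<integral>x. pmf J x * log 2 (pmf J x / (pmf (map_pmf fst J) (fst x) * pmf (map_pmf snd J) (snd x)))
      \<partial>count_space UNIV) < I" and I0: "0 < I" and e: "0 < e"
    and S: "1 / 7 \<le> measure_pmf.prob J {x. snd x \<in> S}"
    and B: "measure_pmf.prob J {x. fst x \<in> B \<and> snd x \<in> S} \<le> e / 192"
  shows "\<exists>w\<in>S. 0 < pmf (map_pmf snd J) w \<and>
    (\<Sum>v\<in>UNIV. pmf J (v, w) * log 2 (pmf J (v, w) / (pmf (map_pmf fst J) v * pmf (map_pmf snd J) w)))
      \<le> 14 * I * pmf (map_pmf snd J) w \<and>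
    (\<Sum>v\<in>UNIV. pmf J (v, w) * indicator B v) \<le> e / 4 * pmf (map_pmf snd J) w"
proof -
  let ?Q = "pmf (map_pmf snd J)"
  define h where "h x = pmf J x * log 2 (pmf J x / (pmf (map_pmf fst J) (fst x) * ?Q (snd x)))" for x
  \<comment> \<open>The constants make the integral of \<open>G\<close> less than \<open>1 + 1 - 2\<close>. The density \<open>h\<close> need not be
    restricted to \<open>S\<close>, because its sum over each fibre is nonnegative.\<close>
  define E F where "E = {x :: 'a \<times> 'w. fst x \<in> B \<and> snd x \<in> S}" and "F = {x :: 'a \<times> 'w. snd x \<in> S}"
  define G where "G x = h x / I + 192 / e * (pmf J x * indicator E x) - 14 * (pmf J x * indicator F x)" for x
  have int_h: "integrable (count_space UNIV) h"
    unfolding h_def by (rule integrable_information_density)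
  have int_G: "integrable (count_space UNIV) G"
    unfolding G_def
    by (intro Bochner_Integration.integrable_diff Bochner_Integration.integrable_add
        integrable_mult_right integrable_divide int_h integral_pmf_indicator(1))
  have "(\<integral>x. G x \<partial>count_space UNIV) = (\<integral>x. h x \<partial>count_space UNIV) / I
      + 192 / e * measure_pmf.prob J E - 14 * measure_pmf.prob J F"
    unfolding G_def
    using int_h integral_pmf_indicator[of J E] integral_pmf_indicator[of J F]
    by simp
  moreover have "(\<integral>x. h x \<partial>count_space UNIV) / I < 1"
    using I I0 by (simp add: h_def)
  moreover have "192 / e * measure_pmf.prob J E \<le> 1"
    using B e by (simp add: E_def field_simps)
  moreover have "2 \<le> 14 * measure_pmf.prob J F"
    using S by (simp add: F_def)
  ultimately have neg: "(\<integral>w. (\<Sum>v\<in>UNIV. G (v, w)) \<partial>count_space UNIV) < 0"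
    using integral_count_space_finite_times(2)[OF int_G] by linarith
  have "\<exists>w. (\<Sum>v\<in>UNIV. G (v, w)) < 0"
  proof (rule ccontr)
    assume "\<not> ?thesis"
    then have "0 \<le> (\<integral>w. (\<Sum>v\<in>UNIV. G (v, w)) \<partial>count_space UNIV)"
      by (intro Bochner_Integration.integral_nonneg) (simp add: not_less)
    with neg show False by simp
  qed
  then obtain w where w: "(\<Sum>v\<in>UNIV. G (v, w)) < 0" ..
  define d where "d = (\<Sum>v\<in>UNIV. h (v, w))"
  define n where "n = (\<Sum>v\<in>UNIV. pmf J (v, w) * indicator B v)"
  have d0: "0 \<le> d"
    unfolding d_def h_def using sum_information_density_nonneg[of J w] by simp
  have n0: "0 \<le> n" unfolding n_def by (intro sum_nonneg) auto
  have sumG: "(\<Sum>v\<in>UNIV. G (v, w)) = d / I + 192 / e * (\<Sum>v\<in>UNIV. pmf J (v, w) * indicator E (v, w))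
      - 14 * (\<Sum>v\<in>UNIV. pmf J (v, w) * indicator F (v, w))"
    unfolding G_def d_def by (simp only: sum.distrib sum_subtractf sum_distrib_left sum_divide_distrib)
  \<comment> \<open>Outside \<open>S\<close> both indicators vanish, and the remaining fibre sum
    \<open>d / I\<close> is nonnegative.\<close>
  have "w \<in> S"
  proof (rule ccontr)
    assume "w \<notin> S"
    then have "(\<Sum>v\<in>UNIV. G (v, w)) = d / I"
      unfolding sumG by (simp add: E_def F_def)
    then show False using w d0 I0 by (simp add: divide_less_0_iff)
  qed
  then have ind: "indicator E (v, w) = (indicator B v :: real)" "indicator F (v, w) = (1 :: real)" for v
    by (auto simp: E_def F_def indicator_def)
  have "(\<Sum>v\<in>UNIV. G (v, w)) = d / I + 192 / e * n - 14 * ?Q w"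
    unfolding sumG ind n_def by (simp add: pmf_map_snd_finite)
  then have less: "d / I + 192 / e * n < 14 * ?Q w" using w by simp
  have "0 \<le> d / I" "0 \<le> 192 / e * n" using d0 n0 I0 e by auto
  with less have *: "d / I < 14 * ?Q w" "192 / e * n < 14 * ?Q w" "0 < ?Q w" by linarith+
  have "d \<le> 14 * I * ?Q w" using *(1) I0 by (simp add: field_simps)
  \<comment> \<open>The factor obtained is 14/192, which is below 1/4.\<close>
  moreover have "n \<le> e / 4 * ?Q w"
  proof -
    have "192 * n \<le> 14 * (e * ?Q w)" using *(2) e by (simp add: field_simps)
    moreover have "0 \<le> e * ?Q w" using e by simp
    ultimately show ?thesis by simp
  qed
  ultimately show ?thesis
    using \<open>w \<in> S\<close> *(3) by (intro bexI[of _ w]) (auto simp: d_def n_def h_def)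
qed

section \<open>From low information cost to a large monochromatic rectangle\<close>

lemma icost_nonneg:
  fixes P :: "('x::finite, 'y::finite, 'z) protocol"
  shows "0 \<le> icost P \<mu>"
proof -
  let ?J = "execution P \<mu>"
  have "icost P \<mu> = (\<integral>w. (\<Sum>v\<in>UNIV. pmf ?J (v, w) *
      log 2 (pmf ?J (v, w) / (pmf (map_pmf fst ?J) v * pmf (map_pmf snd ?J) w))) \<partial>count_space UNIV)"
    using integral_count_space_finite_times(2)[OF integrable_information_density[of ?J]]
    by (simp add: icost_eq map_fst_execution)
  also have "\<dots> \<ge> 0"
    by (intro Bochner_Integration.integral_nonneg sum_information_density_nonneg)
  finally show ?thesis .
qed

text \<open>The vertex argument divides by \<open>e\<close>, hence \<open>0 < e\<close>. The
  additive 8 is 400 times the 1/50 of the theorem.\<close>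

lemma large_monochromatic_rectangle:
  fixes P :: "('x::finite, 'y::finite, 'z) protocol" and f g :: "'x \<times> 'y \<Rightarrow> 'z option"
  assumes z: "3 / 20 \<le> measure_pmf.prob (pair_pmf p q) (f -` {Some z})"
    and P: "computes P (pair_pmf p q) \<epsilon> f"
    and g: "measure_pmf.prob (pair_pmf p q) {xy. f xy \<noteq> g xy} \<le> \<epsilon>"
    and e: "384 * \<epsilon> \<le> e" "0 < e" "e < 1 / 4"
  shows "\<exists>S. rectangle S \<and> monochromatic e z g (pair_pmf p q) S \<and>
    2 powr - (400 * icost P (pair_pmf p q) + 8) \<le> measure_pmf.prob (pair_pmf p q) S"
proof -
  define J where "J = execution P (pair_pmf p q)"
  let ?I = "icost P (pair_pmf p q)" and ?Q = "pmf (map_pmf snd J)"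
  let ?err = "{(xy, t, r). f xy \<noteq> None \<and> Some (out P t) \<noteq> f xy}"
  define Z where "Z = {(t, r :: nat). out P t = z}"
  define B where "B = - (g -` {Some z} \<union> g -` {None})"
  have fst: "map_pmf fst J = pair_pmf p q"
    by (simp add: J_def map_fst_execution)
  have err: "measure_pmf.prob J ?err \<le> \<epsilon>"
    using P by (simp add: computes_def J_def)
  have marginal: "measure_pmf.prob J (fst -` A) = measure_pmf.prob (pair_pmf p q) A" for A
    by (simp flip: fst)
  \<comment> \<open>On inputs with value \<open>z\<close> the output is \<open>z\<close> unless the
    protocol errs. Since \<epsilon> is below 1/1536, \<open>3 / 20 - \<epsilon>\<close> still
    exceeds 1/7.\<close>
  have "3 / 20 \<le> measure_pmf.prob J (fst -` (f -` {Some z}))"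
    using z by (simp only: marginal)
  also have "\<dots> \<le> measure_pmf.prob J ({x. snd x \<in> Z} \<union> ?err)"
    by (rule measure_pmf.finite_measure_mono) (auto simp: Z_def)
  also have "\<dots> \<le> measure_pmf.prob J {x. snd x \<in> Z} + measure_pmf.prob J ?err"
    by (rule measure_Un_le) auto
  finally have Z: "1 / 7 \<le> measure_pmf.prob J {x. snd x \<in> Z}"
    using err e by simp
  \<comment> \<open>Output \<open>z\<close> on an input in \<open>B\<close> means that
    \<open>f\<close> and \<open>g\<close> differ there or that the protocol errs on
    \<open>f\<close>. Each event has probability at most \<epsilon>, and
    \<open>2 * \<epsilon> \<le> e / 192\<close>.\<close>
  have "measure_pmf.prob J {x. fst x \<in> B \<and> snd x \<in> Z}
      \<le> measure_pmf.prob J (fst -` {xy. f xy \<noteq> g xy} \<union> ?err)"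
    by (rule measure_pmf.finite_measure_mono) (auto simp: Z_def B_def)
  also have "\<dots> \<le> measure_pmf.prob J (fst -` {xy. f xy \<noteq> g xy}) + measure_pmf.prob J ?err"
    by (rule measure_Un_le) auto
  finally have bad: "measure_pmf.prob J {x. fst x \<in> B \<and> snd x \<in> Z} \<le> e / 192"
    using err g e by (simp only: marginal)
  \<comment> \<open>Adding 1/100 makes the bound strict and positive.\<close>
  have "(\<integral>x. pmf J x * log 2 (pmf J x / (pmf (map_pmf fst J) (fst x) * ?Q (snd x))) \<partial>count_space UNIV)
      < ?I + 1 / 100"
    unfolding fst by (simp add: J_def icost_eq)
  moreover have "0 < ?I + 1 / 100" using icost_nonneg[of P "pair_pmf p q"] by linarith
  ultimately obtain w where w: "0 < ?Q w"
    "(\<Sum>v\<in>UNIV. pmf J (v, w) * log 2 (pmf J (v, w) / (pmf (pair_pmf p q) v * ?Q w)))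
      \<le> 14 * (?I + 1 / 100) * ?Q w"
    "(\<Sum>v\<in>UNIV. pmf J (v, w) * indicator B v) \<le> e / 4 * ?Q w"
    using exists_good_observation[OF _ _ e(2) Z bad] unfolding fst by blast
  obtain a b where ab: "\<And>x. 0 \<le> a x" "\<And>y. 0 \<le> b y"
    "\<And>x y. pmf J ((x, y), w) = pmf p x * pmf q y * (a x * b y)"
    using pmf_execution_product[of P p q w] unfolding J_def by blast
  have UNIV_sum: "(\<Sum>v\<in>UNIV. F v) = (\<Sum>x\<in>UNIV. \<Sum>y\<in>UNIV. F (x, y))" for F :: "'x \<times> 'y \<Rightarrow> real"
    by (simp add: sum.cartesian_product)
  define a0 b0 where "a0 = (\<Sum>x\<in>UNIV. pmf p x * a x)" and "b0 = (\<Sum>y\<in>UNIV. pmf q y * b y)"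
  have Q: "?Q w = a0 * b0"
    by (simp add: pmf_map_snd_finite UNIV_sum ab a0_def b0_def sum_product mult_ac)
  have "0 \<le> a0" "0 \<le> b0" unfolding a0_def b0_def by (auto intro!: sum_nonneg simp: ab)
  with w(1) have pos: "0 < a0" "0 < b0" by (auto simp: Q zero_less_mult_iff)
  \<comment> \<open>As \<open>?Q w\<close> is \<open>a0 * b0\<close>, normalising each factor
    separately gives exactly the density of the inputs conditioned on \<open>w\<close>.\<close>
  define \<alpha> \<beta> where "\<alpha> x = a x / a0" and "\<beta> y = b y / b0" for x y
  have J: "pmf J ((x, y), w) = ?Q w * (pmf p x * pmf q y * (\<alpha> x * \<beta> y))" for x y
    using pos by (simp add: ab \<alpha>_def \<beta>_def Q)
  have log_J: "pmf J ((x, y), w) * log 2 (pmf J ((x, y), w) / (pmf (pair_pmf p q) (x, y) * ?Q w))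
      = ?Q w * (pmf p x * pmf q y * (\<alpha> x * \<beta> y * log 2 (\<alpha> x * \<beta> y)))" for x y
    using w(1) by (simp add: J pmf_pair)
  define D where "D = (\<Sum>x\<in>UNIV. \<Sum>y\<in>UNIV. pmf p x * pmf q y * (\<alpha> x * \<beta> y * log 2 (\<alpha> x * \<beta> y)))"
  have "?Q w * D \<le> ?Q w * (14 * (?I + 1 / 100))"
    using w(2) unfolding UNIV_sum log_J D_def by (simp add: sum_distrib_left mult_ac)
  then have D: "D \<le> 14 * (?I + 1 / 100)" using w(1) by simp
  have "?Q w * (\<Sum>x\<in>UNIV. \<Sum>y\<in>UNIV. pmf p x * pmf q y * (\<alpha> x * \<beta> y) * indicator B (x, y)) \<le> ?Q w * (e / 4)"
    using w(3) unfolding UNIV_sum J sum_distrib_left by (simp only: mult_ac)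
  then have "(\<Sum>x\<in>UNIV. \<Sum>y\<in>UNIV. pmf p x * pmf q y * (\<alpha> x * \<beta> y) * indicator B (x, y)) \<le> e / 4"
    using w(1) by (simp only: mult_le_cancel_left_pos)
  moreover have "(\<Sum>x\<in>UNIV. pmf p x * \<alpha> x) = 1" "(\<Sum>y\<in>UNIV. pmf q y * \<beta> y) = 1"
    using pos by (simp_all add: \<alpha>_def \<beta>_def a0_def b0_def flip: sum_divide_distrib)
  moreover have "0 \<le> \<alpha> x" "0 \<le> \<beta> y" for x y using ab pos by (simp_all add: \<alpha>_def \<beta>_def)
  ultimately obtain S T where ST:
    "measure_pmf.prob (pair_pmf p q) (S \<times> T \<inter> B) \<le> e * measure_pmf.prob (pair_pmf p q) (S \<times> T)"
    "2 powr - (4 * D + 34 / 5) \<le> measure_pmf.prob (pair_pmf p q) (S \<times> T)"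
    using large_rectangle_of_product_density[of \<alpha> p \<beta> q e B D] e(2) D_def by blast
  \<comment> \<open>The bound on \<open>D\<close> yields the exponent \<open>56 * ?I + 7.36\<close>
    at most.\<close>
  have "2 powr - (400 * ?I + 8) \<le> 2 powr - (4 * D + 34 / 5)"
    using D icost_nonneg[of P "pair_pmf p q"] by simp
  with ST(2) have "2 powr - (400 * ?I + 8) \<le> measure_pmf.prob (pair_pmf p q) (S \<times> T)" by linarith
  moreover have "monochromatic e z g (pair_pmf p q) (S \<times> T)"
    using ST(1) by (simp add: monochromatic_def B_def Diff_eq)
  ultimately show ?thesis
    unfolding rectangle_def by blast
qed

section \<open>The case of error zero and the passage to the corruption bounds\<close>

text \<open>Every event has probability 0 or at least the smallest positive point mass
  \<open>m\<close>, so an error bound below \<open>m\<close> forces error 0. This supplies a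
  positive error parameter when \<open>\<epsilon>' = 0\<close>.\<close>

lemma monochromatic_zero_of_small_error:
  fixes \<mu> :: "('x::finite \<times> 'y::finite) pmf"
  shows "\<exists>e. 0 < e \<and> e < 1 / 4 \<and> (\<forall>z g S. monochromatic e z g \<mu> S \<longrightarrow> monochromatic 0 z g \<mu> S)"
proof -
  define m where "m = Min (pmf \<mu> ` set_pmf \<mu>)"
  have m: "m \<le> pmf \<mu> v" if "v \<in> set_pmf \<mu>" for v
    using that by (simp add: m_def)
  have "m \<in> pmf \<mu> ` set_pmf \<mu>"
    unfolding m_def by (rule Min_in) (auto simp: set_pmf_not_empty)
  then have m0: "0 < m" by (auto simp: pmf_positive)
  define e where "e = min (1 / 8) (m / 2)"
  have "monochromatic 0 z g \<mu> S" if "monochromatic e z g \<mu> S" for z g S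
  proof -
    let ?A = "S - (g -` {Some z} \<union> g -` {None})"
    have "measure_pmf.prob \<mu> ?A \<le> e * measure_pmf.prob \<mu> S"
      using that by (simp add: monochromatic_def)
    also have "\<dots> \<le> e * 1"
      using m0 by (intro mult_left_mono) (auto simp: e_def)
    also have "\<dots> < m" using m0 by (simp add: e_def)
    finally have small: "measure_pmf.prob \<mu> ?A < m" .
    have "v \<notin> set_pmf \<mu>" if "v \<in> ?A" for v
    proof
      assume "v \<in> set_pmf \<mu>"
      then have "m \<le> pmf \<mu> v" by (rule m)
      also have "\<dots> \<le> measure_pmf.prob \<mu> ?A"
        unfolding measure_pmf_single[symmetric]
        using that by (intro measure_pmf.finite_measure_mono) auto
      finally show False using small by simp
    qed
    then have "measure_pmf.prob \<mu> ?A = 0"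
      by (subst measure_pmf_zero_iff) blast
    then show ?thesis by (simp add: monochromatic_def)
  qed
  then show ?thesis using m0 by (intro exI[of _ e]) (auto simp: e_def)
qed

text \<open>The positive lower bound on the maximum also rules out the infinite value of
  \<open>neg_log2\<close>.\<close>

lemma cb_le:
  assumes "rectangle S" "monochromatic \<epsilon> z g \<mu> S" "2 powr - c \<le> measure_pmf.prob \<mu> S"
  shows "cb z \<mu> \<epsilon> g \<le> ereal c"
proof -
  let ?M = "{measure_pmf.prob \<mu> S | S. rectangle S \<and> monochromatic \<epsilon> z g \<mu> S}"
  have "measure_pmf.prob \<mu> S \<le> Max ?M"
    using assms by (intro Max_ge) auto
  with assms(3) have le: "2 powr - c \<le> Max ?M" by linarith
  then have pos: "0 < Max ?M"
    using powr_gt_zero[of 2 "- c"] by linarith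
  have "- c \<le> log 2 (Max ?M)"
    using le pos by (simp add: le_log_iff)
  then show ?thesis
    using pos by (simp add: cb_def neg_log2_def)
qed

theorem theorem3p1:
  fixes f :: "'x::finite \<times> 'y::finite \<Rightarrow> 'z::finite option"
    and \<rho> :: "('x \<times> 'y) pmf"
    and z :: 'z
    and \<epsilon> \<epsilon>' :: real
  assumes "rectangular \<rho>"
    and "measure_pmf.prob \<rho> (f -` {Some z}) \<ge> 3 / 20"
    and "0 \<le> 384 * \<epsilon>"
    and "384 * \<epsilon> \<le> \<epsilon>'"
    and "\<epsilon>' < 1 / 4"
  shows "IC \<rho> \<epsilon> f \<ge> ereal (1 / 400) * scb z \<rho> \<epsilon>' \<epsilon> f - ereal (1 / 50)"
proof -
  obtain p q where \<rho>: "\<rho> = pair_pmf p q"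
    using assms(1) by (auto simp: rectangular_def)
  have "ereal (1 / 400) * scb z \<rho> \<epsilon>' \<epsilon> f - ereal (1 / 50) \<le> ereal (icost P \<rho>)"
    if P: "computes P \<rho> \<epsilon> f" for P :: "('x, 'y, 'z) protocol"
  proof -
    have cb: "cb z \<rho> \<epsilon>' g \<le> ereal (400 * icost P \<rho> + 8)"
      if g: "measure_pmf.prob \<rho> {xy. f xy \<noteq> g xy} \<le> \<epsilon>" for g
    proof -
      \<comment> \<open>If \<open>\<epsilon>' = 0\<close>, then \<epsilon> is 0 as well and a tiny
        positive \<open>e\<close> replaces \<epsilon>'; otherwise \<open>e\<close> is \<epsilon>'
        itself.\<close>
      obtain e where e: "384 * \<epsilon> \<le> e" "0 < e" "e < 1 / 4"
        "\<And>S. monochromatic e z g \<rho> S \<Longrightarrow> monochromatic \<epsilon>' z g \<rho> S"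
      proof (cases "\<epsilon>' = 0")
        case True
        with monochromatic_zero_of_small_error[of \<rho>] obtain e where "0 < e" "e < 1 / 4"
          "\<forall>z (g :: 'x \<times> 'y \<Rightarrow> 'z option) S. monochromatic e z g \<rho> S \<longrightarrow> monochromatic \<epsilon>' z g \<rho> S"
          by auto
        then show ?thesis using True assms that[of e] by auto
      next
        case False
        then show ?thesis using assms that[of \<epsilon>'] by auto
      qed
      from large_monochromatic_rectangle[of p q f z P \<epsilon> g e, folded \<rho>, OF assms(2) P g e(1-3)]
      obtain S where "rectangle S" "monochromatic e z g \<rho> S"
        "2 powr - (400 * icost P \<rho> + 8) \<le> measure_pmf.prob \<rho> S"
        by blast
      then show ?thesis using e(4) by (intro cb_le) auto
    qed
    have "scb z \<rho> \<epsilon>' \<epsilon> f \<le> ereal (400 * icost P \<rho> + 8)"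
      unfolding scb_def
    proof (rule Max.boundedI)
      \<comment> \<open>The function \<open>f\<close> itself is admissible, since it differs from
        itself with probability 0.\<close>
      show "{cb z \<rho> \<epsilon>' g | g. measure_pmf.prob \<rho> {xy. f xy \<noteq> g xy} \<le> \<epsilon>} \<noteq> {}"
        using assms(3) by (auto intro!: exI[of _ f])
    qed (auto intro: cb)
    then have "ereal (1 / 400) * scb z \<rho> \<epsilon>' \<epsilon> f \<le> ereal (1 / 400) * ereal (400 * icost P \<rho> + 8)"
      by (intro ereal_mult_left_mono) auto
    then have "ereal (1 / 400) * scb z \<rho> \<epsilon>' \<epsilon> f - ereal (1 / 50)
        \<le> ereal (1 / 400) * ereal (400 * icost P \<rho> + 8) - ereal (1 / 50)"
      by (intro ereal_minus_mono) auto
    also have "\<dots> = ereal (icost P \<rho>)"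
      by (simp add: field_simps)
    finally show ?thesis .
  qed
  then show ?thesis
    unfolding IC_def by (intro Inf_greatest) auto
qed

end
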